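(* Let $\alpha,\delta\in\mathbb{F}\setminus\{\frac12\}$ with $\alpha\neq\delta$, and let $\mathbf{A}$ be the 5-dimensional LV algebra with natural basis $e_1,\dots,e_5$ in which $e_1e_k=\alpha e_1+(1-\alpha)e_k$ for $k\in\{2,3,5\}$, $e_1e_4=\delta e_1+(1-\delta)e_4$, and $e_ie_j=\frac12(e_i+e_j)$ for all $i,j\in\{2,3,4,5\}$. Then $\mathrm{Der}(\mathbf{A})=\{f\in L(\mathbf{A}) : f(e_1)=f(e_4)=0 \text{ and } \mathrm{Im}(f)\subseteq\langle e_2-e_3,\,e_2-e_5\rangle\}$.
   Context: Let $\mathbb{F}$ be a field of characteristic different from $2$. A Lotka–Volterra (LV) algebra of dimension $5$ over $\mathbb{F}$ is a commutative (not necessarily associative) $\mathbb{F}$-algebra $\mathbf{A}$ with a basis $e_1,\dots,e_5$ (the natural basis) such that $e_ie_j=\alpha_{ij}e_i+\alpha_{ji}e_j$ with $\alpha_{ij}\in\mathbb{F}$, $\alpha_{ii}=\frac12$ and $\alpha_{ij}+\alpha_{ji}=1$ for all $i,j$. A derivation is a linear map $D:\mathbf{A}\to\mathbf{A}$ with $D(uv)=D(u)v+uD(v)$ for all $u,v$; $\mathrm{Der}(\mathbf{A})$ is the set of derivations, $L(\mathbf{A})$ the set of linear maps $\mathbf{A}\to\mathbf{A}$, and $\langle x_1,\dots,x_k\rangle$ the linear span. *)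

theory Defs
  imports "HOL-Analysis.Analysis"
begin

text \<open>Index set of the natural basis e_1,...,e_5.\<close>
datatype idx5 = I1 | I2 | I3 | I4 | I5

lemma UNIV_idx5: "(UNIV :: idx5 set) = {I1, I2, I3, I4, I5}"
  by (auto intro: idx5.exhaust)

instance idx5 :: finite
  by standard (simp add: UNIV_idx5)

text \<open>The algebra A is the F-vector space F^5 = 'a^idx5 (coordinates w.r.t. the natural basis).\<close>
definition nb :: "idx5 \<Rightarrow> 'a::field ^ idx5" where
  "nb i = (\<chi> j. if j = i then 1 else 0)"

text \<open>LV product determined by structure constants: e_i e_j = alpha i j e_i + alpha j i e_j,
  extended bilinearly.\<close>
definition lv_mult :: "(idx5 \<Rightarrow> idx5 \<Rightarrow> 'a::field) \<Rightarrow> 'a ^ idx5 \<Rightarrow> 'a ^ idx5 \<Rightarrow> 'a ^ idx5" where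
  "lv_mult alpha u v =
     (\<Sum>i\<in>UNIV. \<Sum>j\<in>UNIV. (u $ i * v $ j) *s (alpha i j *s nb i + alpha j i *s nb j))"

text \<open>Structure constants of the algebra in the theorem.\<close>
definition alphaA :: "'a::field \<Rightarrow> 'a \<Rightarrow> idx5 \<Rightarrow> idx5 \<Rightarrow> 'a" where
  "alphaA a d i j =
     (if i = j then 1/2
      else if i = I1 then (if j = I4 then d else a)
      else if j = I1 then (if i = I4 then 1 - d else 1 - a)
      else 1/2)"

text \<open>Derivations: linear maps D with D(uv) = D(u)v + uD(v).\<close>
definition is_derivation :: "('a::field ^ idx5 \<Rightarrow> 'a ^ idx5 \<Rightarrow> 'a ^ idx5) \<Rightarrow> ('a ^ idx5 \<Rightarrow> 'a ^ idx5) \<Rightarrow> bool" where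
  "is_derivation pr D \<longleftrightarrow> Vector_Spaces.linear (*s) (*s) D \<and>
     (\<forall>u v. D (pr u v) = pr (D u) v + pr u (D v))"

end

theory Submission
  imports Defs
begin

text \<open>Write d_i = D(e_i). Read coordinatewise, the derivation identity on a pair of basis
  vectors is linear in the d_i. For i = j it kills every coordinate m of d_i with
  alpha_mi \<noteq> 1/2 and makes the weighted sum of the coordinates of d_i with weights alpha_il
  vanish; this gives d_1 = 0. The pair (1, j) then separates coordinate 4 from coordinates
  2, 3, 5 because alpha \<noteq> delta, which gives d_4 = 0 and puts d_2, d_3, d_5 into
  W = <e_2 - e_3, e_2 - e_5>.

  Conversely, with lambda(u) = (1 - alpha) u_1 + (u_2 + u_3 + u_4 + u_5)/2, the product with
  w \<in> W is u w = lambda(u) w, and the projection pi onto coordinates 2, 3, 5 satisfies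
  pi(u v) = lambda(v) pi(u) + lambda(u) pi(v). A linear map killing e_1 and e_4 factors
  through pi, so if its image lies in W it is a derivation.\<close>

lemma all_idx5: "(\<forall>i::idx5. P i) \<longleftrightarrow> P I1 \<and> P I2 \<and> P I3 \<and> P I4 \<and> P I5"
  by (metis idx5.exhaust)

lemma sum_idx5: "(\<Sum>i\<in>(UNIV::idx5 set). f i) = f I1 + f I2 + f I3 + f I4 + f I5"
  by (simp add: UNIV_idx5 add.assoc)

lemma nb_component: "nb i $ j = (if j = i then 1 else 0)"
  by (simp add: nb_def)

lemma lv_mult_component:
  "lv_mult al u v $ k = u$k * (\<Sum>j\<in>UNIV. al k j * v$j) + v$k * (\<Sum>j\<in>UNIV. al k j * u$j)"
  unfolding lv_mult_def
  by (cases k; simp add: nb_def sum_idx5 algebra_simps)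

lemma lv_mult_commute: "lv_mult al u v = lv_mult al v u"
  by (simp add: vec_eq_iff lv_mult_component algebra_simps)

lemma lv_mult_nb_nb: "lv_mult al (nb i) (nb j) = al i j *s nb i + al j i *s nb j"
  by (simp add: vec_eq_iff lv_mult_component nb_component if_distrib[of "\<lambda>x. _ * x"] cong: if_cong)

lemma lv_mult_nb_component:
  "lv_mult al u (nb j) $ m = u$m * al m j + (if m = j then \<Sum>l\<in>UNIV. al j l * u$l else 0)"
  by (simp add: lv_mult_component nb_component if_distrib[of "\<lambda>x. _ * x"] cong: if_cong)

lemma linear_nb_expansion:
  assumes "Vector_Spaces.linear (*s) (*s) f"
  shows "f x = (\<Sum>i\<in>UNIV. x$i *s f (nb i))"
proof -
  have "f x = f (\<Sum>i\<in>UNIV. x$i *s nb i)"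
    using basis_expansion[of x] by (simp add: nb_def axis_def)
  then show ?thesis
    using assms by (simp add: vec.linear_sum vec.linear_scale)
qed

lemma derivation_nb_component:
  assumes "is_derivation (lv_mult al) D"
  shows "al i j * D (nb i) $ m + al j i * D (nb j) $ m =
     D (nb i) $ m * al m j + D (nb j) $ m * al m i
     + (if m = j then \<Sum>l\<in>UNIV. al j l * D (nb i) $ l else 0)
     + (if m = i then \<Sum>l\<in>UNIV. al i l * D (nb j) $ l else 0)"
proof -
  have "Vector_Spaces.linear (*s) (*s) D"
    and "D (lv_mult al (nb i) (nb j)) = lv_mult al (D (nb i)) (nb j) + lv_mult al (nb i) (D (nb j))"
    using assms by (auto simp: is_derivation_def)
  then have "al i j *s D (nb i) + al j i *s D (nb j) =
      lv_mult al (D (nb i)) (nb j) + lv_mult al (D (nb j)) (nb i)"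
    by (simp add: lv_mult_nb_nb vec.linear_add vec.linear_scale lv_mult_commute[of al "nb i"])
  then show ?thesis
    by (simp add: vec_eq_iff lv_mult_nb_component algebra_simps)
qed

lemma derivation_nb_off_diagonal:
  assumes "is_derivation (lv_mult al) D" and "al i i = 1/2" and "(2::'a::field) \<noteq> 0"
    and "m \<noteq> i" and "al m i \<noteq> 1/2"
  shows "D (nb i) $ m = (0::'a)"
proof -
  have "D (nb i) $ m = 2 * al m i * D (nb i) $ m"
    using derivation_nb_component[OF assms(1), of i i m] assms(2-4) by (simp add: field_simps)
  then have "(1 - 2 * al m i) * D (nb i) $ m = 0"
    by (simp add: algebra_simps)
  moreover have "1 - 2 * al m i \<noteq> 0"
    using assms(3,5) by (auto simp: field_simps)
  ultimately show ?thesis by simp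
qed

lemma derivation_nb_weight:
  assumes "is_derivation (lv_mult al) D" and "(2::'a::field) \<noteq> 0"
  shows "(\<Sum>l\<in>UNIV. al i l * D (nb i) $ l) = (0::'a)"
  using derivation_nb_component[OF assms(1), of i i i] assms(2) by simp

lemma derivation_nb_of_vanishing:
  assumes "is_derivation (lv_mult al) D" and "D (nb i) = 0"
  shows "(al j i - al m i) * D (nb j) $ m = (if m = i then \<Sum>l\<in>UNIV. al i l * D (nb j) $ l else 0)"
  using derivation_nb_component[OF assms(1), of i j m] assms(2) by (simp add: algebra_simps)

lemma span_e23_e25:
  "vec.span {nb I2 - nb I3, nb I2 - nb I5} =
     {v :: 'a::field ^ idx5. v$I1 = 0 \<and> v$I4 = 0 \<and> v$I2 + v$I3 + v$I5 = 0}"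
proof (intro set_eqI iffI)
  fix v :: "'a ^ idx5"
  assume "v \<in> vec.span {nb I2 - nb I3, nb I2 - nb I5}"
  then obtain k1 k2 where "v = k1 *s (nb I2 - nb I3) + k2 *s (nb I2 - nb I5)"
    by (auto simp: vec.span_insert vec.span_singleton algebra_simps)
  then show "v \<in> {v. v$I1 = 0 \<and> v$I4 = 0 \<and> v$I2 + v$I3 + v$I5 = 0}"
    by (simp add: nb_def)
next
  fix v :: "'a ^ idx5"
  assume "v \<in> {v. v$I1 = 0 \<and> v$I4 = 0 \<and> v$I2 + v$I3 + v$I5 = 0}"
  then have "v = (- v$I3) *s (nb I2 - nb I3) + (- v$I5) *s (nb I2 - nb I5)"
    by (simp add: vec_eq_iff all_idx5 nb_def) (simp add: algebra_simps eq_neg_iff_add_eq_0)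
  then show "v \<in> vec.span {nb I2 - nb I3, nb I2 - nb I5}"
    by (metis vec.span_add vec.span_scale vec.span_base insertI1 insertI2)
qed

lemma linear_range_subset_span:
  assumes "Vector_Spaces.linear (*s) (*s) f" and "\<And>i. f (nb i) \<in> vec.span S"
  shows "range f \<subseteq> vec.span S"
  using assms by (auto simp: linear_nb_expansion intro!: vec.span_sum vec.span_scale)

lemma alphaA_row_I235:
  "k \<noteq> I1 \<Longrightarrow> k \<noteq> I4 \<Longrightarrow> alphaA a d k l = (if l = I1 then 1 - a else 1/2)"
  by (auto simp: alphaA_def)

lemma alphaA_I1_I235: "k \<noteq> I1 \<Longrightarrow> k \<noteq> I4 \<Longrightarrow> alphaA a d I1 k = a"
  by (simp add: alphaA_def)

definition lambdaA :: "'a::field \<Rightarrow> 'a ^ idx5 \<Rightarrow> 'a" where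
  "lambdaA a u = (1 - a) * u$I1 + (u$I2 + u$I3 + u$I4 + u$I5) / 2"

definition proj_I235 :: "'a::field ^ idx5 \<Rightarrow> 'a ^ idx5" where
  "proj_I235 x = (\<chi> k. if k = I1 \<or> k = I4 then 0 else x$k)"

lemma lv_mult_alphaA_span:
  assumes "w \<in> vec.span {nb I2 - nb I3, nb I2 - nb I5}"
  shows "lv_mult (alphaA a d) u w = lambdaA a u *s w"
proof -
  have "w$I1 = 0" "w$I4 = 0" "w$I5 = - w$I2 - w$I3"
    using assms by (auto simp: span_e23_e25 eq_neg_iff_add_eq_0 algebra_simps)
  then show ?thesis
    by (simp add: vec_eq_iff all_idx5 lv_mult_component sum_idx5 alphaA_def lambdaA_def)
      (simp add: algebra_simps add_divide_distrib diff_divide_distrib)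
qed

lemma proj_I235_lv_mult_alphaA:
  "proj_I235 (lv_mult (alphaA a d) u v) = lambdaA a v *s proj_I235 u + lambdaA a u *s proj_I235 v"
  by (simp add: vec_eq_iff all_idx5 proj_I235_def lv_mult_component sum_idx5 alphaA_def lambdaA_def)
    (simp add: algebra_simps add_divide_distrib)

lemma linear_proj_I235:
  assumes "Vector_Spaces.linear (*s) (*s) f" and "f (nb I1) = 0" and "f (nb I4) = 0"
  shows "f (proj_I235 x) = f x"
proof -
  have "x = proj_I235 x + x$I1 *s nb I1 + x$I4 *s nb I4"
    by (simp add: vec_eq_iff all_idx5 proj_I235_def nb_def)
  then have "f x = f (proj_I235 x) + x$I1 *s f (nb I1) + x$I4 *s f (nb I4)"
    using assms(1) by (metis vec.linear_add vec.linear_scale)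
  with assms(2,3) show ?thesis by simp
qed

lemma is_derivation_alphaA_if_range:
  assumes lin: "Vector_Spaces.linear (*s) (*s) f" and f1: "f (nb I1) = 0" and f4: "f (nb I4) = 0"
    and range: "range f \<subseteq> vec.span {nb I2 - nb I3, nb I2 - nb I5}"
  shows "is_derivation (lv_mult (alphaA a d)) f"
  unfolding is_derivation_def
proof (intro conjI allI lin)
  fix u v
  note f_proj = linear_proj_I235[OF lin f1 f4]
  have "f (lv_mult (alphaA a d) u v) = f (proj_I235 (lv_mult (alphaA a d) u v))"
    by (simp only: f_proj)
  also have "\<dots> = lambdaA a v *s f u + lambdaA a u *s f v"
    using lin by (simp add: proj_I235_lv_mult_alphaA vec.linear_add vec.linear_scale f_proj)
  also have "\<dots> = lv_mult (alphaA a d) (f u) v + lv_mult (alphaA a d) u (f v)"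
    using range by (simp add: lv_mult_alphaA_span lv_mult_commute[of _ "f u"] subsetD)
  finally show "f (lv_mult (alphaA a d) u v) = lv_mult (alphaA a d) (f u) v + lv_mult (alphaA a d) u (f v)" .
qed

context
  fixes a d :: "'a::field"
  assumes two: "(2::'a) \<noteq> 0" and ha: "a \<noteq> 1/2" and hd: "d \<noteq> 1/2" and hne: "a \<noteq> d"
begin

lemma I4_coordinate_vanishes:
  assumes "v$I2 + v$I3 + v$I4 + v$I5 = 0" and "a * (v$I2 + v$I3 + v$I5) + d * v$I4 = 0"
  shows "v$I4 = 0"
proof -
  have "(d - a) * v$I4 = a * (v$I2 + v$I3 + v$I5) + d * v$I4 - a * (v$I2 + v$I3 + v$I4 + v$I5)"
    by (simp add: algebra_simps)
  then show ?thesis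
    using assms hne by simp
qed

lemma derivation_alphaA_nb_I1:
  assumes "is_derivation (lv_mult (alphaA a d)) D"
  shows "D (nb I1) = 0"
proof -
  have "alphaA a d m I1 \<noteq> 1/2" if "m \<noteq> I1" for m
    using that two ha hd by (cases m) (auto simp: alphaA_def field_simps)
  then have off: "D (nb I1) $ m = 0" if "m \<noteq> I1" for m
    using derivation_nb_off_diagonal[OF assms] that two by (simp add: alphaA_def)
  then have "D (nb I1) $ I1 / 2 = 0"
    using derivation_nb_weight[OF assms two, of I1] by (simp add: sum_idx5 alphaA_def)
  with off show ?thesis
    using two by (simp add: vec_eq_iff all_idx5)
qed

lemma derivation_alphaA_nb_I4:
  assumes der: "is_derivation (lv_mult (alphaA a d)) D"
  shows "D (nb I4) = 0"
proof -
  let ?w = "D (nb I4)"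
  have killed: "(alphaA a d I4 I1 - alphaA a d m I1) * ?w $ m =
      (if m = I1 then \<Sum>l\<in>UNIV. alphaA a d I1 l * ?w $ l else 0)" for m
    using derivation_nb_of_vanishing[OF der derivation_alphaA_nb_I1[OF der]] .
  have w1: "?w $ I1 = 0"
    using derivation_nb_off_diagonal[OF der, of I4 I1] two hd by (simp add: alphaA_def field_simps)
  have "?w $ I2 + ?w $ I3 + ?w $ I4 + ?w $ I5 = 0"
    using derivation_nb_weight[OF der two, of I4] w1 two by (simp add: sum_idx5 alphaA_def field_simps)
  moreover have "a * (?w $ I2 + ?w $ I3 + ?w $ I5) + d * ?w $ I4 = 0"
    using killed[of I1] w1 by (simp add: sum_idx5 alphaA_def algebra_simps)
  ultimately have w4: "?w $ I4 = 0"
    by (rule I4_coordinate_vanishes)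
  have "(a - d) * ?w $ m = 0" if "m \<in> {I2, I3, I5}" for m
    using killed[of m] that by (auto simp: alphaA_def algebra_simps)
  then show ?thesis
    using w1 w4 hne by (simp add: vec_eq_iff all_idx5)
qed

lemma derivation_alphaA_nb_in_span:
  assumes der: "is_derivation (lv_mult (alphaA a d)) D" and k: "k \<noteq> I1" "k \<noteq> I4"
  shows "D (nb k) \<in> vec.span {nb I2 - nb I3, nb I2 - nb I5}"
proof -
  let ?u = "D (nb k)"
  have u1: "?u $ I1 = 0"
    using derivation_nb_off_diagonal[OF der, of k I1] k two ha
    by (simp add: alphaA_row_I235 alphaA_I1_I235 field_simps)
  have "?u $ I2 + ?u $ I3 + ?u $ I4 + ?u $ I5 = 0"
    using derivation_nb_weight[OF der two, of k] u1 k two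
    by (simp add: sum_idx5 alphaA_row_I235 field_simps)
  moreover have "a * (?u $ I2 + ?u $ I3 + ?u $ I5) + d * ?u $ I4 = 0"
    using derivation_nb_of_vanishing[OF der derivation_alphaA_nb_I1[OF der], of k I1] u1 k
    by (simp add: sum_idx5 alphaA_row_I235 alphaA_def algebra_simps)
  ultimately have "?u $ I4 = 0" and "?u $ I2 + ?u $ I3 + ?u $ I5 = 0"
    using I4_coordinate_vanishes[of ?u] by (auto simp: algebra_simps)
  with u1 show ?thesis
    by (simp add: span_e23_e25)
qed

lemma derivation_alphaA_range:
  assumes der: "is_derivation (lv_mult (alphaA a d)) D"
  shows "range D \<subseteq> vec.span {nb I2 - nb I3, nb I2 - nb I5}"
proof (rule linear_range_subset_span)
  show "Vector_Spaces.linear (*s) (*s) D"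
    using der by (simp add: is_derivation_def)
  show "D (nb i) \<in> vec.span {nb I2 - nb I3, nb I2 - nb I5}" for i
    using derivation_alphaA_nb_in_span[OF der] derivation_alphaA_nb_I1[OF der] derivation_alphaA_nb_I4[OF der]
    by (cases "i = I1 \<or> i = I4") (auto simp: vec.span_zero)
qed

end

theorem mainTheorem9:
  fixes a d :: "'a::field"
  assumes char: "(2::'a) \<noteq> 0"
    and ha: "a \<noteq> 1/2" and hd: "d \<noteq> 1/2" and hne: "a \<noteq> d"
  shows "{D. is_derivation (lv_mult (alphaA a d)) D} =
         {f. Vector_Spaces.linear (*s) (*s) f \<and> f (nb I1) = 0 \<and> f (nb I4) = 0 \<and>
             range f \<subseteq> vec.span {nb I2 - nb I3, nb I2 - nb I5}}"
proof (intro set_eqI iffI, unfold mem_Collect_eq)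
  fix D :: "'a ^ idx5 \<Rightarrow> 'a ^ idx5"
  assume der: "is_derivation (lv_mult (alphaA a d)) D"
  then show "Vector_Spaces.linear (*s) (*s) D \<and> D (nb I1) = 0 \<and> D (nb I4) = 0 \<and>
      range D \<subseteq> vec.span {nb I2 - nb I3, nb I2 - nb I5}"
    using derivation_alphaA_nb_I1[OF assms der] derivation_alphaA_nb_I4[OF assms der]
      derivation_alphaA_range[OF assms der] by (simp add: is_derivation_def)
next
  fix f :: "'a ^ idx5 \<Rightarrow> 'a ^ idx5"
  assume "Vector_Spaces.linear (*s) (*s) f \<and> f (nb I1) = 0 \<and> f (nb I4) = 0 \<and>
      range f \<subseteq> vec.span {nb I2 - nb I3, nb I2 - nb I5}"
  then show "is_derivation (lv_mult (alphaA a d)) f"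
    using is_derivation_alphaA_if_range by blast
qed

end
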